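(* For $m\in\mathbb N$, $m\ge1$, let $K=K_m$ be the following random walk on the $2m$-vertex "pince-nez" graph with state space $\Omega=\Omega_1\cup\Omega_2$, $\Omega_1=\{1,\dots,m\}$, $\Omega_2=\{m+1,\dots,2m\}$: for $x\ne y$ with $x,y\in\Omega_1$ or $x,y\in\Omega_2$, $K(x,y)=\frac16$ if $|x-y|=1$ or $\{x,y\}\in\{\{1,m\},\{m+1,2m\}\}$; $K(1,m+1)=K(m+1,1)=\frac16$; $K(x,y)=0$ for all other $x\ne y$; and $K(x,x)=1-\sum_{y\ne x}K(x,y)$. Then the mixing time of $K_m$ is $O(m^2)$, and hence its relaxation time is also $O(m^2)$, i.e. there is a constant $C<\infty$ such that both are at most $Cm^2$ for all $m\ge1$.
   Context: The mixing time of a Markov chain with stationary distribution $\pi$ is the smallest $t>0$ such that $\max_x\|\mathcal L(X_t\mid X_0=x)-\pi\|_{\mathrm{TV}}<\frac14$. The relaxation time is the reciprocal of the spectral gap $1-\lambda_2$, where $\lambda_2$ is the second-largest eigenvalue of $K$. *)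

theory Defs
  imports
    Complex_Main
    "HOL-Library.Extended_Real"
    "HOL-Library.Extended_Nat"
    "HOL-Library.Multiset"
    "HOL-Computational_Algebra.Polynomial"
    "Jordan_Normal_Form.Char_Poly"
begin

text \<open>
  A finite Markov chain with n states is given by its n by n transition matrix P,
  the states being the matrix indices 0, ..., n - 1.
\<close>

definition stationary_distribution :: "real mat \<Rightarrow> real vec \<Rightarrow> bool" where
  "stationary_distribution P \<pi> \<longleftrightarrow>
     \<pi> \<in> carrier_vec (dim_row P) \<and>
     (\<forall>i<dim_row P. 0 \<le> \<pi> $ i) \<and>
     (\<Sum>i<dim_row P. \<pi> $ i) = 1 \<and>
     transpose_mat P *\<^sub>v \<pi> = \<pi>"

definition law :: "real mat \<Rightarrow> nat \<Rightarrow> nat \<Rightarrow> real vec" where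
  "law P x t = row (P ^\<^sub>m t) x"

definition tv_dist :: "real vec \<Rightarrow> real vec \<Rightarrow> real" where
  "tv_dist \<mu> \<nu> =
     Max ((\<lambda>A. \<bar>(\<Sum>i\<in>A. \<mu> $ i) - (\<Sum>i\<in>A. \<nu> $ i)\<bar>) ` Pow {..<dim_vec \<mu>})"

text \<open>The infimum over the empty set is infinite: a chain that never mixes has mixing
  time infinity.\<close>

definition mixing_time :: "real mat \<Rightarrow> real vec \<Rightarrow> enat" where
  "mixing_time P \<pi> =
     Inf {enat t | t. 0 < t \<and> Max ((\<lambda>x. tv_dist (law P x t) \<pi>) ` {..<dim_row P}) < 1 / 4}"

text \<open>Real eigenvalues in decreasing order, repeated according to algebraic multiplicity.
  For a chain that is reversible with respect to a positive distribution all eigenvalues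
  are real.\<close>

definition eigenvalues_desc :: "real mat \<Rightarrow> real list" where
  "eigenvalues_desc P = rev (sorted_list_of_multiset (proots (char_poly P)))"

definition second_eigenvalue :: "real mat \<Rightarrow> real" where
  "second_eigenvalue P = eigenvalues_desc P ! 1"

text \<open>The reciprocal is taken in the extended reals, where the inverse of 0 is infinity
  (in the reals it would be 0).\<close>

definition relaxation_time :: "real mat \<Rightarrow> ereal" where
  "relaxation_time P = inverse (ereal (1 - second_eigenvalue P))"

definition pn_offdiag :: "nat \<Rightarrow> nat \<Rightarrow> nat \<Rightarrow> real" where
  "pn_offdiag m x y =
     (if ({x, y} \<subseteq> {1..m} \<or> {x, y} \<subseteq> {m + 1..2 * m}) \<and>
         (\<bar>int x - int y\<bar> = 1 \<or> {x, y} \<in> {{1, m}, {m + 1, 2 * m}})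
         \<or> {x, y} = {1, m + 1}
      then 1 / 6 else 0)"

definition pn_kernel :: "nat \<Rightarrow> nat \<Rightarrow> nat \<Rightarrow> real" where
  "pn_kernel m x y =
     (if x = y then 1 - (\<Sum>z\<in>{1..2 * m} - {x}. pn_offdiag m x z) else pn_offdiag m x y)"

text \<open>The vertex x in {1..2m} is the matrix index x - 1.\<close>

definition pince_nez :: "nat \<Rightarrow> real mat" where
  "pince_nez m = mat (2 * m) (2 * m) (\<lambda>(i, j). pn_kernel m (i + 1) (j + 1))"

lemma pn_offdiag_sym: "pn_offdiag m x y = pn_offdiag m y x"
  unfolding pn_offdiag_def by (simp add: insert_commute abs_minus_commute)

lemma pn_kernel_sym: "pn_kernel m x y = pn_kernel m y x"
  unfolding pn_kernel_def using pn_offdiag_sym[of m x y] by auto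

lemma pn_kernel_row_sum:
  assumes "x \<in> {1..2 * m}"
  shows "(\<Sum>y\<in>{1..2 * m}. pn_kernel m x y) = 1"
proof -
  have "(\<Sum>y\<in>{1..2 * m}. pn_kernel m x y)
      = pn_kernel m x x + (\<Sum>y\<in>{1..2 * m} - {x}. pn_kernel m x y)"
    using assms by (simp add: sum.remove)
  also have "(\<Sum>y\<in>{1..2 * m} - {x}. pn_kernel m x y)
      = (\<Sum>y\<in>{1..2 * m} - {x}. pn_offdiag m x y)"
    by (rule sum.cong) (auto simp: pn_kernel_def)
  finally show ?thesis by (simp add: pn_kernel_def)
qed

lemma uniform_stationary:
  assumes "m \<ge> 1"
  shows "stationary_distribution (pince_nez m) (vec (2 * m) (\<lambda>_. 1 / real (2 * m)))"
proof -
  have col: "(\<Sum>j = 0..<2 * m. pn_kernel m (j + 1) (i + 1)) = 1" if "i < 2 * m" for i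
  proof -
    have "(\<Sum>j = 0..<2 * m. pn_kernel m (j + 1) (i + 1))
        = (\<Sum>j = 0..<2 * m. pn_kernel m (i + 1) (Suc j))"
      by (rule sum.cong) (auto simp: pn_kernel_sym)
    also have "\<dots> = (\<Sum>y = 1..2 * m. pn_kernel m (i + 1) y)"
      using sum.shift_bounds_Suc_ivl[of "pn_kernel m (i + 1)" 0 "2 * m"]
      by (simp add: atLeastLessThanSuc_atLeastAtMost)
    also have "\<dots> = 1"
      using that by (intro pn_kernel_row_sum) auto
    finally show ?thesis .
  qed
  show ?thesis
    unfolding stationary_distribution_def
  proof (intro conjI)
    show "transpose_mat (pince_nez m) *\<^sub>v vec (2 * m) (\<lambda>_. 1 / real (2 * m))
        = vec (2 * m) (\<lambda>_. 1 / real (2 * m))"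
    proof (rule eq_vecI)
      fix i
      assume "i < dim_vec (vec (2 * m) (\<lambda>_. 1 / real (2 * m)))"
      then have i: "i < 2 * m" by simp
      have "(transpose_mat (pince_nez m) *\<^sub>v vec (2 * m) (\<lambda>_. 1 / real (2 * m))) $ i
          = (\<Sum>j = 0..<2 * m. pn_kernel m (j + 1) (i + 1) * (1 / real (2 * m)))"
        using i by (simp add: pince_nez_def scalar_prod_def)
      also have "\<dots> = 1 / real (2 * m)"
        unfolding sum_distrib_right[symmetric] col[OF i] by simp
      finally show "(transpose_mat (pince_nez m) *\<^sub>v vec (2 * m) (\<lambda>_. 1 / real (2 * m))) $ i
          = vec (2 * m) (\<lambda>_. 1 / real (2 * m)) $ i"
        using i by simp
    qed (simp add: pince_nez_def)
  qed (use assms in \<open>auto simp: pince_nez_def\<close>)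
qed

end

theory Submission
  imports Defs "Jordan_Normal_Form.Schur_Decomposition"
begin

text \<open>Let D(f) be the Dirichlet form of K and f_t = K^t f. Laziness (K(x,x) is at least 1/2) gives
  |f_{t+1}|^2 + D(f_t) \<le> |f_t|^2 and makes D(f_t) nonincreasing, so t D(f_t) \<le> |f_0|^2, which is at most 2 m
  for an indicator f_0. Cauchy-Schwarz along a spanning path of edges of weight 1/6 bounds the
  squared oscillation of f by O(m) D(f). Hence the oscillation of f_t drops below 1/4 already for
  t of order m^2; no spectral decomposition, which would cost a factor log m, is involved.
  The same path bound applied to an eigenfunction of mean zero is a Poincare inequality, so every
  eigenvalue other than 1 is at most 1 - 1/(48 m^2). As the second eigenvalue is an entry
  of a list of roots with multiplicity, one also needs that all roots of the characteristic
  polynomial are real and that 1 is a simple root; the latter is read off the first two columns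
  of a Schur triangularisation.\<close>

section \<open>Inequalities for weighted sums\<close>

text \<open>Lagrange's identity: the nonnegative double sum of w_i w_j (a_i - a_j)^2 is twice the
  difference of the two sides.\<close>

lemma sum_mult_squared_le:
  fixes w a :: "'a \<Rightarrow> real"
  assumes "\<And>i. i \<in> A \<Longrightarrow> 0 \<le> w i"
  shows "(\<Sum>i\<in>A. w i * a i)\<^sup>2 \<le> (\<Sum>i\<in>A. w i) * (\<Sum>i\<in>A. w i * (a i)\<^sup>2)"
proof -
  have "0 \<le> (\<Sum>i\<in>A. \<Sum>j\<in>A. w i * w j * (a i - a j)\<^sup>2)"
    using assms by (intro sum_nonneg mult_nonneg_nonneg) auto
  also have "\<dots> = (\<Sum>i\<in>A. \<Sum>j\<in>A. (w i * (a i)\<^sup>2) * w j + w i * (w j * (a j)\<^sup>2)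
      - 2 * ((w i * a i) * (w j * a j)))"
    by (intro sum.cong refl) (simp add: power2_eq_square algebra_simps)
  also have "\<dots> = 2 * ((\<Sum>i\<in>A. w i) * (\<Sum>i\<in>A. w i * (a i)\<^sup>2)) - 2 * (\<Sum>i\<in>A. w i * a i)\<^sup>2"
    by (simp only: sum.distrib sum_subtractf sum_distrib_left[symmetric] sum_distrib_right[symmetric]
        power2_eq_square[of "sum _ _"] mult.commute[of "\<Sum>i\<in>A. w i * (a i)\<^sup>2"] mult_2)
  finally show ?thesis by simp
qed

lemma abs_diff_average_less:
  fixes f w :: "'a \<Rightarrow> real"
  assumes w: "\<And>j. j \<in> A \<Longrightarrow> 0 \<le> w j" "(\<Sum>j\<in>A. w j) = 1"
    and less: "\<And>j. j \<in> A \<Longrightarrow> \<bar>a - f j\<bar> < e" and A: "finite A" "A \<noteq> {}"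
  shows "\<bar>a - (\<Sum>j\<in>A. w j * f j)\<bar> < e"
proof -
  \<comment> \<open>The maximum over the finite set \<open>A\<close> is still below
    \<open>e\<close>; averaging preserves the bound \<open>B\<close>, which keeps the final
    inequality strict.\<close>
  define B where "B = Max ((\<lambda>j. \<bar>a - f j\<bar>) ` A)"
  have "B < e"
    unfolding B_def using A less by (subst Max_less_iff) auto
  have "a - (\<Sum>j\<in>A. w j * f j) = (\<Sum>j\<in>A. w j * (a - f j))"
    by (simp add: right_diff_distrib sum_subtractf sum_distrib_right[symmetric] w(2))
  then have "\<bar>a - (\<Sum>j\<in>A. w j * f j)\<bar> \<le> (\<Sum>j\<in>A. \<bar>w j * (a - f j)\<bar>)"
    by (simp only: sum_abs)
  also have "\<dots> \<le> (\<Sum>j\<in>A. w j * B)"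
    using w(1) A unfolding B_def by (intro sum_mono) (simp add: abs_mult mult_left_mono)
  also have "\<dots> = B"
    by (simp add: sum_distrib_right[symmetric] w(2))
  finally show ?thesis
    using \<open>B < e\<close> by simp
qed

section \<open>Lazy symmetric chains and their Dirichlet form\<close>

locale lazy_symmetric_chain =
  fixes n :: nat and p :: "nat \<Rightarrow> nat \<Rightarrow> real"
  assumes symmetric: "\<lbrakk>x < n; y < n\<rbrakk> \<Longrightarrow> p x y = p y x"
    and nonneg: "\<lbrakk>x < n; y < n\<rbrakk> \<Longrightarrow> 0 \<le> p x y"
    and row_sum: "x < n \<Longrightarrow> (\<Sum>y<n. p x y) = 1"
    and lazy: "x < n \<Longrightarrow> 1 / 2 \<le> p x x"
begin

definition step :: "(nat \<Rightarrow> real) \<Rightarrow> nat \<Rightarrow> real" where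
  "step f x = (\<Sum>y<n. p x y * f y)"

definition lap :: "(nat \<Rightarrow> real) \<Rightarrow> nat \<Rightarrow> real" where
  "lap f x = f x - step f x"

definition normsq :: "(nat \<Rightarrow> real) \<Rightarrow> real" where
  "normsq f = (\<Sum>x<n. (f x)\<^sup>2)"

text \<open>The Dirichlet form with respect to counting measure, for which symmetry makes the chain
  reversible; the half corrects for each edge occurring in both orientations.\<close>

definition energy :: "(nat \<Rightarrow> real) \<Rightarrow> real" where
  "energy f = (\<Sum>x<n. \<Sum>y<n. p x y * (f x - f y)\<^sup>2) / 2"

lemma col_sum: "y < n \<Longrightarrow> (\<Sum>x<n. p x y) = 1"
  using row_sum[of y] symmetric[of _ y] sum.cong[of "{..<n}" "{..<n}" "\<lambda>x. p x y" "p y"]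
  by simp

lemma normsq_nonneg: "0 \<le> normsq f"
  by (simp add: normsq_def sum_nonneg)

lemma sum_row_weighted: "(\<Sum>x<n. \<Sum>y<n. p x y * g x) = (\<Sum>x<n. g x)"
  by (simp add: sum_distrib_right[symmetric] row_sum)

lemma sum_col_weighted: "(\<Sum>x<n. \<Sum>y<n. p x y * g y) = (\<Sum>x<n. g x)"
  by (subst sum.swap) (simp add: sum_distrib_right[symmetric] col_sum)

lemma sum_step: "(\<Sum>x<n. step f x) = (\<Sum>x<n. f x)"
  by (simp add: step_def sum_col_weighted)

lemma sum_mult_step_commute: "(\<Sum>x<n. f x * step g x) = (\<Sum>x<n. step f x * g x)"
proof -
  have "(\<Sum>x<n. f x * step g x) = (\<Sum>x<n. \<Sum>y<n. p x y * f x * g y)"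
    by (simp add: step_def sum_distrib_left ac_simps)
  also have "\<dots> = (\<Sum>y<n. \<Sum>x<n. p y x * f x * g y)"
    by (subst sum.swap) (auto intro!: sum.cong simp: symmetric)
  also have "\<dots> = (\<Sum>x<n. step f x * g x)"
    by (simp add: step_def sum_distrib_right)
  finally show ?thesis .
qed

lemma energy_eq: "energy f = (\<Sum>x<n. f x * lap f x)"
proof -
  have "2 * energy f = (\<Sum>x<n. \<Sum>y<n. p x y * (f x)\<^sup>2 + p x y * (f y)\<^sup>2
      - 2 * (f x * (p x y * f y)))"
    unfolding energy_def by (simp, intro sum.cong refl) (simp add: power2_eq_square algebra_simps)
  also have "\<dots> = 2 * (\<Sum>x<n. (f x)\<^sup>2) - 2 * (\<Sum>x<n. f x * step f x)"
    unfolding sum.distrib sum_subtractf sum_row_weighted sum_col_weighted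
      sum_distrib_left[symmetric] step_def by simp
  finally show ?thesis
    by (simp add: lap_def algebra_simps sum_subtractf power2_eq_square)
qed

text \<open>Here laziness enters. The diagonal drops out of \<open>lap f x\<close>, the other
  weights of the row sum to at most 1/2, and Cauchy-Schwarz yields the factor 1/2. In operator terms
  L^2 <= L for L = I - P, that is, no eigenvalue of P is negative.\<close>

lemma normsq_lap_le: "normsq (lap f) \<le> energy f"
proof -
  have "(lap f x)\<^sup>2 \<le> (\<Sum>y<n. p x y * (f x - f y)\<^sup>2) / 2" if x: "x < n" for x
  proof -
    have "lap f x = (\<Sum>y<n. p x y * (f x - f y))"
      by (simp add: lap_def step_def right_diff_distrib sum_subtractf
          sum_distrib_right[symmetric] row_sum x)
    also have "\<dots> = (\<Sum>y\<in>{..<n} - {x}. p x y * (f x - f y))"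
      using x by (simp add: sum.remove)
    finally have "(lap f x)\<^sup>2 \<le> (\<Sum>y\<in>{..<n} - {x}. p x y)
        * (\<Sum>y\<in>{..<n} - {x}. p x y * (f x - f y)\<^sup>2)"
      using nonneg x by (auto intro!: sum_mult_squared_le)
    also have "\<dots> \<le> 1 / 2 * (\<Sum>y\<in>{..<n} - {x}. p x y * (f x - f y)\<^sup>2)"
    proof (rule mult_right_mono)
      show "(\<Sum>y\<in>{..<n} - {x}. p x y) \<le> 1 / 2"
        using row_sum[OF x] lazy[OF x] x by (simp add: sum.remove)
    qed (use nonneg x in \<open>auto intro!: sum_nonneg\<close>)
    finally show ?thesis
      using x by (simp add: sum.remove)
  qed
  then have "normsq (lap f) \<le> (\<Sum>x<n. (\<Sum>y<n. p x y * (f x - f y)\<^sup>2) / 2)"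
    unfolding normsq_def by (intro sum_mono) auto
  then show ?thesis
    by (simp add: energy_def sum_divide_distrib)
qed

text \<open>The operator bound L <= 2, from (a - b)^2 <= 2 a^2 + 2 b^2; applied to
  \<open>lap f\<close> it shows that the energy does not increase.\<close>

lemma energy_le: "energy f \<le> 2 * normsq f"
proof -
  have "(\<Sum>x<n. \<Sum>y<n. p x y * (f x - f y)\<^sup>2)
      \<le> (\<Sum>x<n. \<Sum>y<n. p x y * (2 * (f x)\<^sup>2) + p x y * (2 * (f y)\<^sup>2))"
  proof (intro sum_mono)
    fix x y assume "x \<in> {..<n}" "y \<in> {..<n}"
    moreover have "(f x - f y)\<^sup>2 \<le> 2 * (f x)\<^sup>2 + 2 * (f y)\<^sup>2"
      using zero_le_power2[of "f x + f y"] by (simp add: power2_sum power2_diff)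
    ultimately show "p x y * (f x - f y)\<^sup>2 \<le> p x y * (2 * (f x)\<^sup>2) + p x y * (2 * (f y)\<^sup>2)"
      unfolding distrib_left[symmetric] using nonneg by (intro mult_left_mono) auto
  qed
  also have "\<dots> = 4 * normsq f"
    unfolding sum.distrib sum_row_weighted sum_col_weighted
    by (simp add: normsq_def sum_distrib_left[symmetric])
  finally show ?thesis by (simp add: energy_def)
qed

lemma normsq_step_le: "normsq (step f) + energy f \<le> normsq f"
proof -
  \<comment> \<open>Expand the square of \<open>step f = f - lap f\<close>; the cross term is the
    energy by \<open>energy_eq\<close>.\<close>
  have "normsq (step f) = normsq f - 2 * energy f + normsq (lap f)"
    unfolding energy_eq normsq_def lap_def
    by (simp add: sum_distrib_left sum.distrib[symmetric] sum_subtractf[symmetric]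
        power2_eq_square algebra_simps)
  then show ?thesis using normsq_lap_le[of f] by simp
qed

text \<open>With P = I - L for the step operator, self-adjointness gives D(f) - D(P f) = 2 |L f|^2 -
  D(L f), which is nonnegative since L <= 2.\<close>

lemma energy_step_le: "energy (step f) \<le> energy f"
proof -
  have step_lap: "step (lap f) x = step f x - step (step f) x" for x
    by (simp add: lap_def step_def right_diff_distrib sum_subtractf)
  have "energy f - energy (step f) - 2 * normsq (lap f) + energy (lap f)
      = (\<Sum>x<n. f x * step (step f) x - step f x * step f x)"
    unfolding energy_eq normsq_def lap_def step_lap[unfolded lap_def] sum_distrib_left
      sum.distrib[symmetric] sum_subtractf[symmetric]
    by (intro sum.cong refl) (simp add: power2_eq_square algebra_simps)
  also have "\<dots> = 0"
    using sum_mult_step_commute[of f "step f"]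
    by (simp add: sum_subtractf)
  finally show ?thesis using energy_le[of "lap f"] by linarith
qed

text \<open>Each step costs at least the current energy in squared norm, and the energy is
  nonincreasing, so \<open>t\<close> steps cost at least \<open>t\<close> times the last
  energy.\<close>

lemma normsq_energy_funpow_le:
  "normsq ((step ^^ t) f) + real t * energy ((step ^^ t) f) \<le> normsq f"
proof (induction t)
  case (Suc t)
  let ?g = "(step ^^ t) f"
  have "normsq (step ?g) + real (Suc t) * energy (step ?g)
      \<le> normsq (step ?g) + real (Suc t) * energy ?g"
    by (intro add_left_mono mult_left_mono energy_step_le) auto
  also have "\<dots> \<le> normsq ?g + real t * energy ?g"
    using normsq_step_le[of ?g] by (simp add: algebra_simps)
  finally show ?case using Suc.IH by simp
qed simp

text \<open>Telescoping along the path and Cauchy-Schwarz over at most \<open>n\<close> increments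
  cost a factor \<open>n\<close>; each squared increment is charged to a path edge of weight at
  least \<open>c\<close>.\<close>

lemma diff_squared_le_energy:
  assumes s: "bij_betw s {..<n} {..<n}"
    and c: "0 < c" "\<And>k. Suc k < n \<Longrightarrow> c \<le> p (s k) (s (Suc k))"
    and "x < n" "y < n"
  shows "c * (f x - f y)\<^sup>2 \<le> 2 * real n * energy f"
proof -
  let ?d = "\<lambda>k. f (s (Suc k)) - f (s k)"
  have main: "c * (f (s j) - f (s i))\<^sup>2 \<le> 2 * real n * energy f" if "i \<le> j" "j < n" for i j
  proof -
    have "(f (s j) - f (s i))\<^sup>2 = (\<Sum>k\<in>{i..<j}. 1 * ?d k)\<^sup>2"
      using sum_Suc_diff'[of i j "\<lambda>k. f (s k)"] that by simp
    also have "\<dots> \<le> (\<Sum>k\<in>{i..<j}. 1) * (\<Sum>k\<in>{i..<j}. 1 * (?d k)\<^sup>2)"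
      by (rule sum_mult_squared_le) simp
    also have "\<dots> \<le> real n * (\<Sum>k\<in>{i..<j}. (?d k)\<^sup>2)"
      using that by (auto intro!: mult_right_mono sum_nonneg)
    finally have "c * (f (s j) - f (s i))\<^sup>2 \<le> real n * (\<Sum>k\<in>{i..<j}. c * (?d k)\<^sup>2)"
      using c(1) by (simp add: sum_distrib_left[symmetric] mult.left_commute)
    also have "(\<Sum>k\<in>{i..<j}. c * (?d k)\<^sup>2)
        \<le> (\<Sum>k\<in>{i..<j}. p (s k) (s (Suc k)) * (f (s k) - f (s (Suc k)))\<^sup>2)"
      using c(2) that by (intro sum_mono) (auto simp: power2_commute intro!: mult_right_mono)
    \<comment> \<open>Since \<open>s\<close> is injective, the path edges are distinct ordered
      pairs, so their sum is part of the double sum in the energy.\<close>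
    also have "\<dots> = (\<Sum>(x, y)\<in>(\<lambda>k. (s k, s (Suc k))) ` {i..<j}. p x y * (f x - f y)\<^sup>2)"
    proof (subst sum.reindex)
      show "inj_on (\<lambda>k. (s k, s (Suc k))) {i..<j}"
        using that by (auto intro!: inj_onI dest!: inj_onD[OF bij_betw_imp_inj_on[OF s]])
    qed simp
    also have "\<dots> \<le> (\<Sum>(x, y)\<in>{..<n} \<times> {..<n}. p x y * (f x - f y)\<^sup>2)"
      using that nonneg bij_betwE[OF s] by (intro sum_mono2) auto
    also have "\<dots> = 2 * energy f"
      by (simp add: energy_def sum.cartesian_product)
    finally show ?thesis by (simp add: mult_left_mono)
  qed
  obtain i j where "x = s i" "y = s j" "i < n" "j < n"
    using s assms(4,5) unfolding bij_betw_def by (metis imageE lessThan_iff)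
  then show ?thesis
    using main[of i j] main[of j i] by (cases "i \<le> j") (auto simp: power2_commute)
qed

end

section \<open>Spectrum of real symmetric matrices\<close>

text \<open>The Hermitian form at an eigenvector is \<open>a\<close> times its squared norm and, by
  symmetry, also \<open>cnj a\<close> times it; the squared norm is nonzero.\<close>

lemma symmetric_eigenvalue_real:
  fixes A :: "real mat"
  assumes A: "A \<in> carrier_mat n n" and sym: "transpose_mat A = A"
    and ev: "eigenvalue (map_mat complex_of_real A) a"
  shows "a \<in> \<real>"
proof -
  let ?A = "map_mat complex_of_real A"
  obtain v where v: "v \<in> carrier_vec n" "v \<noteq> 0\<^sub>v n" "?A *\<^sub>v v = a \<cdot>\<^sub>v v"
    using ev A unfolding eigenvalue_def eigenvector_def by auto
  have sym': "A $$ (i, j) = A $$ (j, i)" if "i < n" "j < n" for i j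
    using A that arg_cong[OF sym, of "\<lambda>M. M $$ (i, j)"] by simp
  have row: "(\<Sum>j<n. of_real (A $$ (i, j)) * v $ j) = a * v $ i" if "i < n" for i
    using A v(1) that arg_cong[OF v(3), of "\<lambda>u. u $ i"]
    by (simp add: scalar_prod_def atLeast0LessThan)
  let ?N = "\<Sum>i<n. v $ i * cnj (v $ i)"
  have "a * ?N = (\<Sum>i<n. \<Sum>j<n. of_real (A $$ (i, j)) * v $ j * cnj (v $ i))"
    by (simp add: sum_distrib_left mult.assoc[symmetric] row[symmetric] sum_distrib_right)
  also have "\<dots> = (\<Sum>j<n. \<Sum>i<n. of_real (A $$ (j, i)) * v $ j * cnj (v $ i))"
    by (subst sum.swap) (simp add: sym')
  also have "\<dots> = (\<Sum>j<n. v $ j * cnj (\<Sum>i<n. of_real (A $$ (j, i)) * v $ i))"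
    by (simp add: sum_distrib_left ac_simps)
  also have "\<dots> = cnj a * ?N"
    unfolding sum_distrib_left using row by (intro sum.cong refl) simp
  finally have "(a - cnj a) * ?N = 0"
    by (simp add: algebra_simps)
  moreover have "?N \<noteq> 0"
  proof
    assume "?N = 0"
    then have "(\<Sum>i<n. (cmod (v $ i))\<^sup>2) = 0"
      unfolding complex_norm_square[symmetric] of_real_sum[symmetric] by (simp only: of_real_eq_0_iff)
    then have "\<forall>i<n. v $ i = 0"
      by (simp add: sum_nonneg_eq_0_iff)
    with v(1,2) show False by auto
  qed
  ultimately show ?thesis
    by (simp add: Reals_cnj_iff)
qed

text \<open>Over the complex numbers the polynomial splits; its roots are eigenvalues, hence real,
  and the factorization descends because the embedding of real polynomials is injective.\<close>

lemma char_poly_symmetric_factorized: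
  fixes A :: "real mat"
  assumes A: "A \<in> carrier_mat n n" and sym: "transpose_mat A = A"
  obtains es where "char_poly A = (\<Prod>e\<leftarrow>es. [:- e, 1:])" "length es = n"
proof -
  let ?A = "map_mat complex_of_real A"
  have cA: "?A \<in> carrier_mat n n" using A by simp
  obtain as where as: "char_poly ?A = (\<Prod>a\<leftarrow>as. [:- a, 1:])" "length as = n"
    using char_poly_factorized[OF cA] by auto
  have cp: "char_poly ?A = map_poly complex_of_real (char_poly A)"
    by (rule of_real_hom.char_poly_hom[OF A])
  interpret h: map_poly_inj_idom_hom complex_of_real ..
  have re: "complex_of_real (Re a) = a" if "a \<in> set as" for a
  proof -
    have "poly (char_poly ?A) a = 0"
      unfolding as(1) using that by (rule linear_poly_root)
    then show ?thesis
      using symmetric_eigenvalue_real[OF A sym] eigenvalue_root_char_poly[OF cA] by simp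
  qed
  have "map_poly complex_of_real (char_poly A) = (\<Prod>a\<leftarrow>as. [:- a, 1:])"
    using as(1) cp by simp
  also have "\<dots> = map_poly complex_of_real (\<Prod>a\<leftarrow>as. [:- Re a, 1:])"
    unfolding h.hom_prod_list map_map using re by (auto intro!: arg_cong[of _ _ prod_list])
  finally have "char_poly A = (\<Prod>a\<leftarrow>as. [:- Re a, 1:])"
    by (simp only: h.eq_iff)
  then show thesis
    using as(2) by (intro that[of "map Re as"]) (auto simp: comp_def)
qed

text \<open>As \<open>proots\<close> sees only real roots, full length \<open>n\<close> comes from
  the splitting over the reals. In particular entry 1 of the list exists once n >= 2.\<close>

lemma eigenvalues_desc_symmetric:
  assumes A: "A \<in> carrier_mat n n" and sym: "transpose_mat A = A"
  shows "char_poly A = (\<Prod>e\<leftarrow>eigenvalues_desc A. [:- e, 1:])"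
    and "length (eigenvalues_desc A) = n"
proof -
  obtain es where es: "char_poly A = (\<Prod>e\<leftarrow>es. [:- e, 1:])" "length es = n"
    using char_poly_symmetric_factorized[OF A sym] .
  have "proots (\<Prod>e\<leftarrow>es. [:- e, 1:]) = mset es" for es :: "real list"
    by (induction es) (auto simp: proots_mult image_iff simp del: mult_pCons_left)
  then have mset: "mset (eigenvalues_desc A) = mset es"
    by (simp add: eigenvalues_desc_def es(1))
  then show "length (eigenvalues_desc A) = n"
    using es(2) by (metis size_mset)
  from mset have "prod_mset (image_mset (\<lambda>e. [:- e, 1:]) (mset (eigenvalues_desc A)))
      = prod_mset (image_mset (\<lambda>e. [:- e, 1:]) (mset es))"
    by simp
  then show "char_poly A = (\<Prod>e\<leftarrow>eigenvalues_desc A. [:- e, 1:])"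
    unfolding mset_map[symmetric] prod_mset_prod_list using es(1) by simp
qed

lemma eigenvalues_desc_antimono:
  assumes "i \<le> j" "j < length (eigenvalues_desc A)"
  shows "eigenvalues_desc A ! j \<le> eigenvalues_desc A ! i"
  using assms unfolding eigenvalues_desc_def
  by (auto simp: rev_nth intro!: sorted_nth_mono)

text \<open>In a Schur decomposition \<open>A = P * B * Q\<close> the diagonal of \<open>B\<close>
  keeps the order of \<open>es\<close>, and \<open>A * P = P * B\<close> read in columns 0 and 1
  gives the two equations. \<open>Q\<close> sends these columns to unit vectors, so they are
  independent. This turns a repeated root into a statement about vectors without
  diagonalizing.\<close>

lemma two_triangular_vectors:
  fixes A :: "real mat"
  assumes A: "A \<in> carrier_mat n n"
    and cp: "char_poly A = (\<Prod>e\<leftarrow>es. [:- e, 1:])" and n: "length es = n" "2 \<le> n"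
  obtains v w b where "v \<in> carrier_vec n" "w \<in> carrier_vec n"
    "A *\<^sub>v v = es ! 0 \<cdot>\<^sub>v v" "A *\<^sub>v w = b \<cdot>\<^sub>v v + es ! 1 \<cdot>\<^sub>v w"
    "v \<noteq> 0\<^sub>v n" "\<nexists>k. w = k \<cdot>\<^sub>v v"
proof -
  obtain B P Q where sd: "schur_decomposition A es = (B, P, Q)"
    by (cases "schur_decomposition A es")
  from schur_decomposition[OF A cp sd] have
    wit: "similar_mat_wit A B P Q" and ut: "upper_triangular B" and diag: "diag_mat B = es"
    by auto
  from similar_mat_witD2[OF A wit] have
    QP: "Q * P = 1\<^sub>m n" and AB: "A = P * B * Q"
    and B: "B \<in> carrier_mat n n" and P: "P \<in> carrier_mat n n" and Q: "Q \<in> carrier_mat n n"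
    by auto
  have AP: "A * P = P * B"
    unfolding AB using B P Q QP by (simp add: assoc_mult_mat[of _ n n _ n _ n])
  have es: "es ! k = B $$ (k, k)" if "k < n" for k
    using that B unfolding diag[symmetric] diag_mat_def by simp
  have zero: "B $$ (i, j) = 0" if "j < i" "i < n" for i j
    using ut that B by auto
  have PB: "(A *\<^sub>v col P j) $ i = (\<Sum>k<n. P $$ (i, k) * B $$ (k, j))" if "i < n" "j < n" for i j
  proof -
    have "(A *\<^sub>v col P j) $ i = (A * P) $$ (i, j)"
      using that A P by simp
    then show ?thesis
      unfolding AP using that B P by (simp add: scalar_prod_def atLeast0LessThan)
  qed
  have pair: "Q *\<^sub>v col P j = unit_vec n j" if "j < n" for j
    using that P Q QP by (metis col_mult2 col_one)
  show thesis
  proof (rule that)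
    show "A *\<^sub>v col P 0 = es ! 0 \<cdot>\<^sub>v col P 0"
    proof (rule eq_vecI)
      fix i assume "i < dim_vec (es ! 0 \<cdot>\<^sub>v col P 0)"
      then have i: "i < n" using P by simp
      have "(\<Sum>k<n. P $$ (i, k) * B $$ (k, 0)) = (\<Sum>k\<in>{0}. P $$ (i, k) * B $$ (k, 0))"
        using n zero by (intro sum.mono_neutral_right) auto
      then show "(A *\<^sub>v col P 0) $ i = (es ! 0 \<cdot>\<^sub>v col P 0) $ i"
        using i n P PB[of i 0] es[of 0] by simp
    qed (use A P in simp)
    show "A *\<^sub>v col P 1 = B $$ (0, 1) \<cdot>\<^sub>v col P 0 + es ! 1 \<cdot>\<^sub>v col P 1"
    proof (rule eq_vecI)
      fix i assume "i < dim_vec (B $$ (0, 1) \<cdot>\<^sub>v col P 0 + es ! 1 \<cdot>\<^sub>v col P 1)"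
      then have i: "i < n" using P by simp
      have "(\<Sum>k<n. P $$ (i, k) * B $$ (k, 1)) = (\<Sum>k\<in>{0, 1}. P $$ (i, k) * B $$ (k, 1))"
        using n zero by (intro sum.mono_neutral_right) auto
      then show "(A *\<^sub>v col P 1) $ i = (B $$ (0, 1) \<cdot>\<^sub>v col P 0 + es ! 1 \<cdot>\<^sub>v col P 1) $ i"
        using i n P PB[of i 1] es[of 1] by simp
    qed (use A P in simp)
    show "col P 0 \<noteq> 0\<^sub>v n"
    proof
      assume "col P 0 = 0\<^sub>v n"
      then have "unit_vec n 0 $ 0 = (Q *\<^sub>v 0\<^sub>v n) $ 0"
        using pair[of 0] n by simp
      moreover have "Q *\<^sub>v 0\<^sub>v n = 0\<^sub>v n"
        using Q by (intro eq_vecI) (auto simp: scalar_prod_def)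
      ultimately show False using n by simp
    qed
    show "\<nexists>k. col P 1 = k \<cdot>\<^sub>v col P 0"
    proof
      assume "\<exists>k. col P 1 = k \<cdot>\<^sub>v col P 0"
      then obtain k where "col P 1 = k \<cdot>\<^sub>v col P 0" ..
      then have "unit_vec n 1 = k \<cdot>\<^sub>v unit_vec n 0"
        using pair[of 0] pair[of 1] n P mult_mat_vec[OF Q, of "col P 0" k] by (simp add: carrier_vecI)
      then have "unit_vec n 1 $ 1 = (k \<cdot>\<^sub>v unit_vec n 0) $ 1"
        by simp
      then show False using n by simp
    qed
  qed (use P n in \<open>auto intro!: carrier_vecI\<close>)
qed

section \<open>Chains with a spanning path: oscillation and eigenfunctions\<close>

locale traceable_chain = lazy_symmetric_chain +
  fixes s :: "nat \<Rightarrow> nat" and c :: real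
  assumes path: "bij_betw s {..<n} {..<n}"
    and weight_pos: "0 < c"
    and weight_le: "\<And>k. Suc k < n \<Longrightarrow> c \<le> p (s k) (s (Suc k))"
begin

text \<open>The path bound contributes \<open>2 * real n\<close> times the energy, the decay bound
  makes \<open>t\<close> times the energy at most \<open>normsq g\<close>, and that is at most
  \<open>n\<close> for a function bounded by 1.\<close>

lemma funpow_diff_squared_le:
  assumes "\<And>i. i < n \<Longrightarrow> \<bar>g i\<bar> \<le> 1" "x < n" "y < n"
  shows "c * real t * ((step ^^ t) g x - (step ^^ t) g y)\<^sup>2 \<le> 2 * (real n)\<^sup>2"
proof -
  let ?f = "(step ^^ t) g"
  have "c * real t * (?f x - ?f y)\<^sup>2 = real t * (c * (?f x - ?f y)\<^sup>2)"
    by simp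
  also have "\<dots> \<le> real t * (2 * real n * energy ?f)"
    using diff_squared_le_energy[OF path weight_pos weight_le assms(2,3)]
    by (intro mult_left_mono) auto
  also have "\<dots> = 2 * real n * (real t * energy ?f)"
    by simp
  also have "real t * energy ?f \<le> normsq g"
    using normsq_energy_funpow_le[of t g] normsq_nonneg[of ?f] by linarith
  also have "normsq g \<le> (\<Sum>x<n. 1)"
    unfolding normsq_def using assms(1) by (intro sum_mono) (auto simp: abs_square_le_1)
  finally show ?thesis
    by (simp add: power2_eq_square mult_left_mono)
qed

text \<open>For an eigenvalue other than 1 the eigenfunction sums to zero, as \<open>step\<close>
  preserves sums, and its energy is \<open>(1 - \<mu>) * normsq f\<close>; the Poincare inequality
  then bounds the gap from below.\<close>

lemma eigenfunction_dichotomy: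
  assumes ev: "\<And>x. x < n \<Longrightarrow> step f x = \<mu> * f x" and nz: "x < n" "f x \<noteq> 0"
  shows "\<mu> = 1 \<or> c \<le> 2 * (real n)\<^sup>2 * (1 - \<mu>)"
proof (rule disjCI)
  assume "\<not> c \<le> 2 * (real n)\<^sup>2 * (1 - \<mu>)"
  show "\<mu> = 1"
  proof (rule ccontr)
    assume "\<mu> \<noteq> 1"
    have "\<mu> * (\<Sum>x<n. f x) = (\<Sum>x<n. f x)"
      using sum_step[of f] by (simp add: ev sum_distrib_left)
    with \<open>\<mu> \<noteq> 1\<close> have mean0: "(\<Sum>x<n. f x) = 0" by simp
    have energy: "energy f = (1 - \<mu>) * normsq f"
      by (simp add: energy_eq lap_def ev normsq_def sum_distrib_left power2_eq_square algebra_simps)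
    have "c * (f x)\<^sup>2 \<le> 2 * real n * energy f" if x: "x < n" for x
    proof -
      \<comment> \<open>Mean zero makes \<open>f x\<close> the average of the differences
        \<open>f x - f y\<close>, so the path bound controls \<open>f x\<close> itself.\<close>
      have "real n * f x = (\<Sum>y<n. 1 * (f x - f y))"
        by (simp add: sum_subtractf mean0)
      then have "(real n * f x)\<^sup>2 \<le> real n * (\<Sum>y<n. (f x - f y)\<^sup>2)"
        using sum_mult_squared_le[of "{..<n}" "\<lambda>_. 1" "\<lambda>y. f x - f y"] by simp
      then have "c * (real n * f x)\<^sup>2 \<le> real n * (\<Sum>y<n. c * (f x - f y)\<^sup>2)"
        using weight_pos by (simp add: sum_distrib_left[symmetric] mult.left_commute)
      also have "\<dots> \<le> real n * (\<Sum>y<n. 2 * real n * energy f)"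
        using diff_squared_le_energy[OF path weight_pos weight_le x]
        by (intro mult_left_mono sum_mono) auto
      finally have "(real n)\<^sup>2 * (c * (f x)\<^sup>2) \<le> (real n)\<^sup>2 * (2 * real n * energy f)"
        by (simp add: power_mult_distrib power2_eq_square ac_simps)
      then show ?thesis using x by simp
    qed
    then have "c * normsq f \<le> (\<Sum>x<n. 2 * real n * energy f)"
      unfolding normsq_def sum_distrib_left by (intro sum_mono) auto
    also have "\<dots> = (2 * (real n)\<^sup>2 * (1 - \<mu>)) * normsq f"
      by (simp add: energy power2_eq_square)
    finally have "c \<le> 2 * (real n)\<^sup>2 * (1 - \<mu>)"
    proof (rule mult_right_le_imp_le)
      have "0 < (f x)\<^sup>2" using nz by simp
      also have "\<dots> \<le> normsq f"
        unfolding normsq_def using nz by (intro member_le_sum) auto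
      finally show "0 < normsq f" .
    qed
    with \<open>\<not> c \<le> 2 * (real n)\<^sup>2 * (1 - \<mu>)\<close> show False by contradiction
  qed
qed

text \<open>A fixed function has zero energy, and the path bound then leaves no oscillation.\<close>

lemma harmonic_constant:
  assumes "\<And>x. x < n \<Longrightarrow> step f x = f x" "x < n" "y < n"
  shows "f x = f y"
proof -
  have "energy f = 0"
    by (simp add: energy_eq lap_def assms(1))
  then have "c * (f x - f y)\<^sup>2 \<le> 0"
    using diff_squared_le_energy[OF path weight_pos weight_le assms(2,3), of f] by simp
  then show ?thesis
    using weight_pos by (simp add: mult_le_0_iff)
qed

section \<open>Transition matrix and mixing time\<close>

definition K :: "real mat" where
  "K = mat n n (\<lambda>(i, j). p i j)"

lemma K_carrier [simp]: "K \<in> carrier_mat n n" "dim_row K = n" "dim_col K = n"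
  by (simp_all add: K_def)

lemma transpose_K: "transpose_mat K = K"
  by (rule eq_matI) (auto simp: K_def symmetric)

lemma K_mult_vec: "v \<in> carrier_vec n \<Longrightarrow> x < n \<Longrightarrow> (K *\<^sub>v v) $ x = step (\<lambda>i. v $ i) x"
  by (simp add: K_def scalar_prod_def step_def atLeast0LessThan)

text \<open>Both sides are the expectation of g(X_t) from \<open>x\<close>; this passes from laws to
  evolved functions. The induction varies \<open>g\<close> because the last factor of the matrix
  power acts on \<open>g\<close> first.\<close>

lemma pow_K_row:
  assumes "x < n"
  shows "(\<Sum>i<n. (K ^\<^sub>m t) $$ (x, i) * g i) = (step ^^ t) g x"
proof (induction t arbitrary: g)
  case 0
  have "(\<Sum>i<n. (1\<^sub>m n) $$ (x, i) * g i) = (\<Sum>i\<in>{x}. (1\<^sub>m n) $$ (x, i) * g i)"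
    using assms by (intro sum.mono_neutral_right) auto
  then show ?case using assms by simp
next
  case (Suc t)
  have "(\<Sum>i<n. (K ^\<^sub>m Suc t) $$ (x, i) * g i)
      = (\<Sum>i<n. \<Sum>j<n. (K ^\<^sub>m t) $$ (x, j) * (p j i * g i))"
    using assms pow_carrier_mat[OF K_carrier(1), of t]
    by (auto intro!: sum.cong simp: scalar_prod_def K_def atLeast0LessThan sum_distrib_right mult.assoc)
  also have "\<dots> = (\<Sum>j<n. (K ^\<^sub>m t) $$ (x, j) * step g j)"
    by (subst sum.swap) (simp add: step_def sum_distrib_left)
  also have "\<dots> = (step ^^ t) (step g) x"
    by (rule Suc.IH)
  finally show ?case by (simp add: funpow_swap1)
qed

text \<open>By symmetry of \<open>K\<close> a stationary vector is fixed by \<open>K\<close> itself,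
  and self-adjointness moves \<open>step\<close> onto it. Every stationary \<pi> is thus handled
  directly, without identifying it as uniform.\<close>

lemma stationary_funpow_step:
  assumes "stationary_distribution K \<pi>"
  shows "(\<Sum>j<n. \<pi> $ j * (step ^^ t) g j) = (\<Sum>j<n. \<pi> $ j * g j)"
proof (induction t)
  case (Suc t)
  have \<pi>: "\<pi> \<in> carrier_vec n" "K *\<^sub>v \<pi> = \<pi>"
    using assms by (auto simp: stationary_distribution_def transpose_K)
  have "step (\<lambda>i. \<pi> $ i) x = \<pi> $ x" if "x < n" for x
    using K_mult_vec[OF \<pi>(1) that] \<pi>(2) by simp
  then show ?case
    using Suc sum_mult_step_commute[of "\<lambda>i. \<pi> $ i" "(step ^^ t) g"] by simp
qed simp

text \<open>The law gives an event \<open>A\<close> the value at \<open>x\<close> of the evolved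
  indicator, while stationarity makes the \<pi>-mass of \<open>A\<close> the \<pi>-average of the
  same function; its oscillation bounds the difference.\<close>

lemma tv_dist_law_less:
  assumes st: "stationary_distribution K \<pi>" and x: "x < n" and t: "32 * (real n)\<^sup>2 < c * real t"
  shows "tv_dist (law K x t) \<pi> < 1 / 4"
proof -
  have \<pi>: "\<And>i. i < n \<Longrightarrow> 0 \<le> \<pi> $ i" "(\<Sum>i<n. \<pi> $ i) = 1"
    using st by (auto simp: stationary_distribution_def)
  have dim: "dim_vec (law K x t) = n"
    using pow_carrier_mat[OF K_carrier(1), of t] by (simp add: law_def)
  have "\<bar>(\<Sum>i\<in>A. law K x t $ i) - (\<Sum>i\<in>A. \<pi> $ i)\<bar> < 1 / 4" if A: "A \<subseteq> {..<n}" for A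
  proof -
    let ?g = "\<lambda>i. if i \<in> A then 1 else 0 :: real"
    let ?f = "(step ^^ t) ?g"
    have restrict: "(\<Sum>i\<in>A. h i) = (\<Sum>i<n. h i * ?g i)" for h :: "nat \<Rightarrow> real"
      using A by (simp add: if_distrib[of "\<lambda>z. _ * z"] sum.If_cases Int_absorb1 cong: if_cong)
    have law: "(\<Sum>i\<in>A. law K x t $ i) = ?f x"
      unfolding restrict pow_K_row[OF x, symmetric] law_def
      using x pow_carrier_mat[OF K_carrier(1), of t] by (intro sum.cong) auto
    have osc: "\<bar>?f x - ?f y\<bar> < 1 / 4" if y: "y < n" for y
    proof -
      have "c * real t * (?f x - ?f y)\<^sup>2 \<le> 2 * (real n)\<^sup>2"
        using x y by (intro funpow_diff_squared_le) auto
      \<comment> \<open>The threshold 32 is 2 * 16, the 16 coming from the squared target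
        oscillation 1/4.\<close>
      also have "\<dots> < c * real t * (1 / 4)\<^sup>2"
        using t by (simp add: power2_eq_square)
      finally have "(?f x - ?f y)\<^sup>2 < (1 / 4)\<^sup>2"
        using weight_pos by (simp add: mult_less_cancel_left)
      then show ?thesis
        using power2_less_imp_less[of "\<bar>?f x - ?f y\<bar>" "1 / 4"] by simp
    qed
    have "\<bar>?f x - (\<Sum>j<n. \<pi> $ j * ?f j)\<bar> < 1 / 4"
      using \<pi> x by (intro abs_diff_average_less osc) auto
    then show ?thesis
      unfolding law restrict[of "\<lambda>i. \<pi> $ i"] stationary_funpow_step[OF st, of t ?g] .
  qed
  then show ?thesis
    unfolding tv_dist_def dim by (subst Max_less_iff) auto
qed

lemma mixing_time_le:
  assumes "stationary_distribution K \<pi>" "0 < n" "32 * (real n)\<^sup>2 < c * real t"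
  shows "mixing_time K \<pi> \<le> enat t"
proof -
  \<comment> \<open>The mixing time ranges over positive times only; at \<open>t = 0\<close> the
    hypothesis would put \<open>32 * (real n)\<^sup>2\<close> below 0.\<close>
  have "0 < t"
    using assms(2,3) by (intro gr0I) auto
  moreover have "Max ((\<lambda>x. tv_dist (law K x t) \<pi>) ` {..<dim_row K}) < 1 / 4"
    using assms tv_dist_law_less by (subst Max_less_iff) auto
  ultimately show ?thesis
    unfolding mixing_time_def by (intro Inf_lower) auto
qed

section \<open>Spectral gap and relaxation time\<close>

lemma eigenvalue_dichotomy:
  assumes "eigenvalue K e"
  shows "e = 1 \<or> c \<le> 2 * (real n)\<^sup>2 * (1 - e)"
proof -
  obtain v where v: "v \<in> carrier_vec n" "v \<noteq> 0\<^sub>v n" "K *\<^sub>v v = e \<cdot>\<^sub>v v"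
    using assms by (auto simp: eigenvalue_def eigenvector_def)
  then obtain x where "x < n" "v $ x \<noteq> 0"
    by (metis carrier_vecD eq_vecI index_zero_vec)
  moreover have "step (\<lambda>i. v $ i) x = e * v $ x" if "x < n" for x
    using K_mult_vec[OF v(1) that] v(1,3) that by simp
  ultimately show ?thesis
    by (rule eigenfunction_dichotomy[rotated])
qed

text \<open>Excludes both a second eigenvector and a Jordan block at 1. A fixed \<open>v\<close> is
  a nonzero constant; since \<open>K\<close> preserves coordinate sums, summing the equation for
  \<open>w\<close> forces \<open>b = 0\<close>, and then \<open>w\<close> is constant too.\<close>

lemma one_simple_eigenvalue:
  assumes v: "v \<in> carrier_vec n" "v \<noteq> 0\<^sub>v n" "K *\<^sub>v v = v"
    and w: "w \<in> carrier_vec n" "K *\<^sub>v w = b \<cdot>\<^sub>v v + w"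
  shows "\<exists>k. w = k \<cdot>\<^sub>v v"
proof -
  have n: "0 < n"
    using v(1,2) by (auto intro!: gr0I)
  have const: "u $ i = u $ 0" if "u \<in> carrier_vec n" "K *\<^sub>v u = u" "i < n" for u i
    using K_mult_vec[OF that(1)] that n by (intro harmonic_constant[of "\<lambda>i. u $ i"]) auto
  have v0: "v $ 0 \<noteq> 0"
    using const[OF v(1,3)] v(1,2) by auto
  have "(\<Sum>i<n. w $ i) = (\<Sum>i<n. (K *\<^sub>v w) $ i)"
    using sum_step[of "\<lambda>i. w $ i"] by (simp add: K_mult_vec[OF w(1)] del: index_mult_mat_vec)
  also have "\<dots> = (\<Sum>i<n. b * v $ 0 + w $ i)"
  proof (rule sum.cong)
    fix i assume "i \<in> {..<n}"
    then have "i < n" by simp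
    then show "(K *\<^sub>v w) $ i = b * v $ 0 + w $ i"
      unfolding w(2) const[OF v(1,3) \<open>i < n\<close>, symmetric] using v(1) w(1) by simp
  qed simp
  finally have "b = 0"
    using n v0 by (simp add: sum.distrib)
  then have Kw: "K *\<^sub>v w = w"
    using w v(1) by auto
  have "w = (w $ 0 / v $ 0) \<cdot>\<^sub>v v"
  proof (intro eq_vecI)
    fix i assume "i < dim_vec ((w $ 0 / v $ 0) \<cdot>\<^sub>v v)"
    then have i: "i < n" using v(1) by simp
    show "w $ i = ((w $ 0 / v $ 0) \<cdot>\<^sub>v v) $ i"
      using const[OF w(1) Kw i] const[OF v(1,3) i] v(1) v0 i by simp
  qed (use v(1) w(1) in simp)
  then show ?thesis ..
qed

text \<open>The dichotomy settles a second eigenvalue other than 1. If it were 1, the first would be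
  1 as well, and the two triangular vectors would contradict simplicity.\<close>

lemma spectral_gap_ge:
  assumes n: "2 \<le> n"
  shows "c \<le> 2 * (real n)\<^sup>2 * (1 - second_eigenvalue K)"
proof -
  let ?es = "eigenvalues_desc K"
  note cp = eigenvalues_desc_symmetric[OF K_carrier(1) transpose_K]
  have ev: "eigenvalue K (?es ! i)" if "i < n" for i
  proof -
    have "poly (char_poly K) (?es ! i) = 0"
      by (subst cp(1), rule linear_poly_root) (use that cp(2) in simp)
    then show ?thesis
      by (simp add: eigenvalue_root_char_poly[OF K_carrier(1)])
  qed
  obtain v w b where vw: "v \<in> carrier_vec n" "w \<in> carrier_vec n"
    "K *\<^sub>v v = ?es ! 0 \<cdot>\<^sub>v v" "K *\<^sub>v w = b \<cdot>\<^sub>v v + ?es ! 1 \<cdot>\<^sub>v w"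
    "v \<noteq> 0\<^sub>v n" "\<nexists>k. w = k \<cdot>\<^sub>v v"
    using two_triangular_vectors[OF K_carrier(1) cp n] .
  have "?es ! 1 \<noteq> 1"
  proof
    assume e1: "?es ! 1 = 1"
    then have "1 \<le> ?es ! 0"
      using eigenvalues_desc_antimono[of 0 1 K] cp(2) n by simp
    \<comment> \<open>For a value of at least 1 the second alternative of the dichotomy would give c
      <= 0, so the value is exactly 1.\<close>
    then have "2 * (real n)\<^sup>2 * (1 - ?es ! 0) \<le> 0"
      by (simp add: mult_nonneg_nonpos)
    then have e0: "?es ! 0 = 1"
      using eigenvalue_dichotomy[OF ev[of 0]] n weight_pos by auto
    show False
      using one_simple_eigenvalue[of v w b] vw unfolding e0 e1 by auto
  qed
  then show ?thesis
    using eigenvalue_dichotomy[OF ev[of 1]] n by (auto simp: second_eigenvalue_def)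
qed

lemma relaxation_time_le:
  assumes n: "2 \<le> n"
  shows "relaxation_time K \<le> ereal (2 * (real n)\<^sup>2 / c)"
proof -
  let ?g = "1 - second_eigenvalue K"
  \<comment> \<open>A zero gap would have infinite inverse in the extended reals, so positivity
    comes before the passage to real reciprocals.\<close>
  have "0 < 2 * (real n)\<^sup>2 * ?g"
    using spectral_gap_ge[OF n] weight_pos by linarith
  then have g: "0 < ?g"
    using n by (simp add: zero_less_mult_iff)
  have "1 / ?g \<le> 2 * (real n)\<^sup>2 / c"
    using spectral_gap_ge[OF n] weight_pos g by (simp add: field_simps)
  then show ?thesis
    using g by (simp add: relaxation_time_def inverse_eq_divide)
qed

end

section \<open>The pince-nez walk\<close>

text \<open>Every vertex has at most three neighbours, joined by edges of weight 1/6; this makes the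
  walk lazy.\<close>

lemma sum_pn_offdiag_le:
  assumes "x \<in> {1..2 * m}"
  shows "(\<Sum>z\<in>{1..2 * m} - {x}. pn_offdiag m x z) \<le> 1 / 2"
proof -
  \<comment> \<open>\<open>N\<close> contains all neighbours of \<open>x\<close>. The first two
    cases are the ends of the bridge; otherwise the third entry closes the cycle at
    \<open>x = m\<close> or \<open>x = 2 * m\<close> and is mere padding elsewhere. Entries may
    coincide for small \<open>m\<close>.\<close>
  define N where "N = (if x = 1 then {2, m, m + 1} else if x = m + 1 then {m + 2, 2 * m, 1}
    else {x - 1, x + 1, if x = m then 1 else m + 1})"
  have "card {a, b, d} \<le> 3" for a b d :: nat
    using card_length[of "[a, b, d]"] by simp
  then have N: "finite N" "card N \<le> 3"
    unfolding N_def by simp_all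
  have "(\<Sum>z\<in>{1..2 * m} - {x}. pn_offdiag m x z)
      \<le> (\<Sum>z\<in>{1..2 * m} - {x}. if z \<in> N then 1 / 6 else 0)"
  proof (rule sum_mono)
    fix z assume z: "z \<in> {1..2 * m} - {x}"
    have "z \<in> N" if nz: "pn_offdiag m x z \<noteq> 0"
    proof -
      have "\<bar>int x - int z\<bar> = 1 \<longleftrightarrow> z = x + 1 \<or> x = z + 1" by arith
      \<comment> \<open>The consecutive vertices \<open>m\<close> and \<open>m + 1\<close> lie in
        different cycles, hence the restriction in the second case; for \<open>m = 1\<close> this
        pair is the bridge and falls under the last case.\<close>
      then consider "z = x + 1" | "x = z + 1" "x \<noteq> m + 1"
        | "{x, z} = {1, m}" | "{x, z} = {m + 1, 2 * m}" | "{x, z} = {1, m + 1}"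
        using nz unfolding pn_offdiag_def by (auto split: if_splits)
      then show ?thesis
        by cases (use z assms in \<open>auto simp: N_def doubleton_eq_iff\<close>)
    qed
    then show "pn_offdiag m x z \<le> (if z \<in> N then 1 / 6 else 0)"
      by (auto simp: pn_offdiag_def)
  qed
  also have "\<dots> = real (card (({1..2 * m} - {x}) \<inter> N)) / 6"
    by (simp add: sum.If_cases Int_def)
  also have "\<dots> \<le> 3 / 6"
    using card_mono[OF N(1), of "({1..2 * m} - {x}) \<inter> N"] N(2) by simp
  finally show ?thesis by simp
qed

text \<open>The spanning path runs around the first cycle from vertex m down to vertex 1, crosses the
  bridge to vertex m + 1 and runs around the second cycle up to vertex 2 m; indices start at 0.\<close>

lemma pince_nez_traceable:
  assumes "1 \<le> m"
  shows "traceable_chain (2 * m) (\<lambda>i j. pn_kernel m (i + 1) (j + 1))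
    (\<lambda>k. if k < m then m - 1 - k else k) (1 / 6)"
proof (unfold_locales, goal_cases)
  \<comment> \<open>Cases 1 to 4 are symmetry, nonnegativity, row sums and laziness; cases 5 to 7
    concern the path and its weight 1/6.\<close>
  case (1 x y) show ?case by (rule pn_kernel_sym)
next
  case (2 x y)
  have "0 \<le> pn_offdiag m (x + 1) (y + 1)"
    unfolding pn_offdiag_def by simp
  then show ?case
    unfolding pn_kernel_def using 2 sum_pn_offdiag_le[of "x + 1" m] by (cases "x = y") simp_all
next
  case (3 x)
  have "(\<Sum>y<2 * m. pn_kernel m (x + 1) (y + 1)) = (\<Sum>y\<in>{1..2 * m}. pn_kernel m (x + 1) y)"
    using sum.shift_bounds_Suc_ivl[of "pn_kernel m (x + 1)" 0 "2 * m"]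
    by (simp add: atLeastLessThanSuc_atLeastAtMost atLeast0LessThan)
  also have "\<dots> = 1"
    using 3 by (intro pn_kernel_row_sum) auto
  finally show ?case .
next
  case (4 x)
  then show ?case
    using sum_pn_offdiag_le[of "x + 1" m] by (simp add: pn_kernel_def)
next
  case 5
  have "inj_on (\<lambda>k. if k < m then m - 1 - k else k) {..<2 * m}"
    by (rule inj_onI) (auto split: if_splits)
  then show ?case
    by (intro bij_betw_imageI endo_inj_surj) auto
next
  case 6 then show ?case by simp
next
  case (7 k)
  have adjacent: "1 / 6 \<le> pn_kernel m x y" if "x \<noteq> y"
    "{x, y} \<subseteq> {1..m} \<and> \<bar>int x - int y\<bar> = 1 \<or> {x, y} \<subseteq> {m + 1..2 * m} \<and> \<bar>int x - int y\<bar> = 1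
      \<or> {x, y} = {1, m + 1}" for x y
    using that unfolding pn_kernel_def pn_offdiag_def by simp blast
  \<comment> \<open>At \<open>Suc k = m\<close> the path goes from index 0 to index
    \<open>m\<close>, which is the bridge.\<close>
  consider "Suc k < m" | "Suc k = m" | "m \<le> k" by linarith
  then show ?case
    by cases (rule adjacent; use 7 in \<open>auto simp: of_nat_diff\<close>)+
qed

theorem mainTheorem7:
  shows "\<exists>C::real. \<forall>m::nat. 1 \<le> m \<longrightarrow>
    (\<forall>\<pi>. stationary_distribution (pince_nez m) \<pi> \<longrightarrow>
       ereal_of_enat (mixing_time (pince_nez m) \<pi>) \<le> ereal (C * (real m)\<^sup>2)) \<and>
    relaxation_time (pince_nez m) \<le> ereal (C * (real m)\<^sup>2)"
proof (intro exI[of _ 1000] allI impI conjI)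
  \<comment> \<open>With n = 2 m and c = 1/6 the relaxation bound 2 n^2 / c is 48 m^2, and the
    mixing condition 32 n^2 < c t reads t > 768 m^2; the constant 1000 exceeds both.\<close>
  fix m :: nat assume m: "1 \<le> m"
  interpret traceable_chain "2 * m" "\<lambda>i j. pn_kernel m (i + 1) (j + 1)"
    "\<lambda>k. if k < m then m - 1 - k else k" "1 / 6"
    using m by (rule pince_nez_traceable)
  have K: "pince_nez m = K"
    unfolding pince_nez_def K_def by (rule refl)
  have "relaxation_time (pince_nez m) \<le> ereal (48 * (real m)\<^sup>2)"
    using relaxation_time_le m by (simp add: K power_mult_distrib)
  also have "\<dots> \<le> ereal (1000 * (real m)\<^sup>2)"
    by simp
  finally show "relaxation_time (pince_nez m) \<le> ereal (1000 * (real m)\<^sup>2)" .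
  fix \<pi> assume "stationary_distribution (pince_nez m) \<pi>"
  then have "mixing_time (pince_nez m) \<pi> \<le> enat (1000 * m\<^sup>2)"
    unfolding K using m by (intro mixing_time_le) (auto simp: power_mult_distrib)
  then have "ereal_of_enat (mixing_time (pince_nez m) \<pi>) \<le> ereal_of_enat (enat (1000 * m\<^sup>2))"
    by (simp only: ereal_of_enat_le_iff)
  then show "ereal_of_enat (mixing_time (pince_nez m) \<pi>) \<le> ereal (1000 * (real m)\<^sup>2)"
    by simp
qed

end
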